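(* Let $G$ be a finite simple graph and let $R$ and $C$ be subsets of $V(G)$ with $|R|=|C|$. Then $(R,C)$ is a persistent triangle of $G$ if and only if $V(G)\setminus C$ is a zero forcing set for $G$ from which $R$ can be the set of vertices that force.
   Context: A zero-nonzero pattern is a matrix with entries in $\{0,*\}$; a square pattern is a triangle if some permutation of its rows followed by some independent permutation of its columns yields a lower-triangular pattern with only $*$ entries on the diagonal. $\mathcal{S}_{\mathrm{znz}}(G)$ is the set of the $2^{|G|}$ symmetric $V(G)\times V(G)$ zero-nonzero patterns whose off-diagonal $(i,j)$ entry is $*$ exactly when $\{i,j\}\in E(G)$, with arbitrary diagonal. $(R,C)$ with $|R|=|C|$ is a persistent triangle of $G$ if $\mathcal A[R,C]$ (rows $R$, columns $C$) is a triangle for every $\mathcal A\in \mathcal{S}_{\mathrm{znz}}(G)$. Zero forcing rule: a filled vertex $v$ forces (fills) an unfilled vertex $u$ if $u$ is the only unfilled neighbor of $v$; each vertex forces at most once. A forcing sequence from $F$ is a sequence of forces each allowed when starting with $F$ filled after the previous forces; it is complete if no further force is possible afterwards. $F$ is a zero forcing set if repeated forcing fills all of $V(G)$. "$F$ is a zero forcing set from which $R$ can be the set of vertices that force" means $F$ is a zero forcing set and some complete forcing sequence from $F$ has exactly $R$ as its set of forcing vertices. *)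

theory Defs
  imports "Graph_Theory.Pair_Digraph" "HOL-Library.FuncSet"
begin

text \<open>
  A finite simple graph is a \<open>pair_graph\<close> (finite, symmetric, loop-free): the edge \<open>{u, v}\<close>
  is represented by the two arcs \<open>(u, v)\<close> and \<open>(v, u)\<close>.
\<close>

datatype znz = Zero | Star

text \<open>
  Patterns are indexed by sets. They are extensional functions, so that two patterns with the
  same entries are equal (cf. \<open>card_S_znz\<close> below).
\<close>

definition patterns :: "'a set \<Rightarrow> 'b set \<Rightarrow> ('a \<times> 'b \<Rightarrow> znz) set" where
  "patterns R C = (R \<times> C \<rightarrow>\<^sub>E UNIV)"

definition subpattern ::
  "('a \<times> 'b \<Rightarrow> znz) \<Rightarrow> 'a set \<Rightarrow> 'b set \<Rightarrow> ('a \<times> 'b \<Rightarrow> znz)" where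
  "subpattern A R C = restrict A (R \<times> C)"

definition lower_triangular_star_diag :: "nat \<Rightarrow> (nat \<Rightarrow> nat \<Rightarrow> znz) \<Rightarrow> bool" where
  "lower_triangular_star_diag n M \<longleftrightarrow>
     (\<forall>i<n. \<forall>j<n. i < j \<longrightarrow> M i j = Zero) \<and> (\<forall>i<n. M i i = Star)"

text \<open>
  The rows and columns of a set-indexed pattern carry no order; permuting them independently
  means choosing independent enumerations \<open>r\<close> of \<open>R\<close> and \<open>c\<close> of \<open>C\<close>.
\<close>

definition triangle :: "'a set \<Rightarrow> 'b set \<Rightarrow> ('a \<times> 'b \<Rightarrow> znz) \<Rightarrow> bool" where
  "triangle R C A \<longleftrightarrow> card R = card C \<and>
     (\<exists>r c. bij_betw r {..<card R} R \<and> bij_betw c {..<card C} C \<and>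
        lower_triangular_star_diag (card R) (\<lambda>i j. A (r i, c j)))"

definition S_znz :: "'a pair_pre_digraph \<Rightarrow> ('a \<times> 'a \<Rightarrow> znz) set" where
  "S_znz G = {A \<in> patterns (pverts G) (pverts G).
     (\<forall>i\<in>pverts G. \<forall>j\<in>pverts G. A (i, j) = A (j, i)) \<and>
     (\<forall>i\<in>pverts G. \<forall>j\<in>pverts G. i \<noteq> j \<longrightarrow> (A (i, j) = Star \<longleftrightarrow> (i, j) \<in> parcs G))}"

definition persistent_triangle :: "'a pair_pre_digraph \<Rightarrow> 'a set \<Rightarrow> 'a set \<Rightarrow> bool" where
  "persistent_triangle G R C \<longleftrightarrow>
     R \<subseteq> pverts G \<and> C \<subseteq> pverts G \<and> card R = card C \<and>
     (\<forall>A\<in>S_znz G. triangle R C (subpattern A R C))"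

text \<open>\<open>forces G B v u\<close>: when the filled vertices are those in \<open>B\<close>, \<open>v\<close> can force \<open>u\<close>.\<close>

definition forces :: "'a pair_pre_digraph \<Rightarrow> 'a set \<Rightarrow> 'a \<Rightarrow> 'a \<Rightarrow> bool" where
  "forces G B v u \<longleftrightarrow> v \<in> B \<and> {w. (v, w) \<in> parcs G \<and> w \<notin> B} = {u}"

text \<open>
  A force of \<open>u\<close> by \<open>v\<close> is the pair \<open>(v, u)\<close>. That each vertex forces at most once need not be
  required; see \<open>forcing_sequence_distinct\<close> below.
\<close>

primrec forcing_sequence ::
  "'a pair_pre_digraph \<Rightarrow> 'a set \<Rightarrow> ('a \<times> 'a) list \<Rightarrow> bool" where
  "forcing_sequence G B [] \<longleftrightarrow> True"
| "forcing_sequence G B (f # fs) \<longleftrightarrow>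
     forces G B (fst f) (snd f) \<and> forcing_sequence G (insert (snd f) B) fs"

definition filled_after :: "'a set \<Rightarrow> ('a \<times> 'a) list \<Rightarrow> 'a set" where
  "filled_after B fs = B \<union> snd ` set fs"

definition complete_forcing_sequence ::
  "'a pair_pre_digraph \<Rightarrow> 'a set \<Rightarrow> ('a \<times> 'a) list \<Rightarrow> bool" where
  "complete_forcing_sequence G B fs \<longleftrightarrow>
     forcing_sequence G B fs \<and> \<not> (\<exists>v u. forces G (filled_after B fs) v u)"

definition forcing_vertices :: "('a \<times> 'a) list \<Rightarrow> 'a set" where
  "forcing_vertices fs = fst ` set fs"

definition zero_forcing_set :: "'a pair_pre_digraph \<Rightarrow> 'a set \<Rightarrow> bool" where
  "zero_forcing_set G F \<longleftrightarrow> F \<subseteq> pverts G \<and>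
     (\<exists>fs. forcing_sequence G F fs \<and> filled_after F fs = pverts G)"

definition zero_forcing_set_with_forcers ::
  "'a pair_pre_digraph \<Rightarrow> 'a set \<Rightarrow> 'a set \<Rightarrow> bool" where
  "zero_forcing_set_with_forcers G F R \<longleftrightarrow> zero_forcing_set G F \<and>
     (\<exists>fs. complete_forcing_sequence G F fs \<and> forcing_vertices fs = R)"

lemma forcing_sequence_forcer_has_unfilled_neighbor:
  assumes "forcing_sequence G B fs" "v \<in> fst ` set fs"
  shows "\<exists>w. (v, w) \<in> parcs G \<and> w \<notin> B"
  using assms
proof (induction fs arbitrary: B)
  case (Cons f fs)
  show ?case
  proof (cases "v = fst f")
    case True
    with Cons.prems(1) have "{w. (v, w) \<in> parcs G \<and> w \<notin> B} = {snd f}"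
      by (simp add: forces_def)
    then show ?thesis
      by blast
  next
    case False
    with Cons.prems(2) have "v \<in> fst ` set fs"
      by simp
    with Cons.IH[of "insert (snd f) B"] Cons.prems(1) show ?thesis
      by auto
  qed
qed simp

lemma forcing_sequence_distinct:
  "forcing_sequence G B fs \<Longrightarrow> distinct (map fst fs)"
proof (induction fs arbitrary: B)
  case (Cons f fs)
  then have "fst f \<notin> fst ` set fs"
    using forcing_sequence_forcer_has_unfilled_neighbor[of G "insert (snd f) B" fs "fst f"]
    by (auto simp: forces_def)
  with Cons show ?case
    by auto
qed simp

lemma card_S_znz:
  assumes "pair_graph G"
  shows "card (S_znz G) = 2 ^ card (pverts G)"
proof -
  interpret pair_graph G
    by (fact assms)
  let ?V = "pverts G"
  define pat where
    "pat D = restrict (\<lambda>(i, j). if (i, j) \<in> parcs G \<or> i = j \<and> i \<in> D then Star else Zero) (?V \<times> ?V)"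
    for D
  have arcs_sym: "(i, j) \<in> parcs G \<longleftrightarrow> (j, i) \<in> parcs G" for i j
    using pair_sym_arcs by (auto simp: symmetric_def sym_def)
  have irrefl: "(i, i) \<notin> parcs G" for i
    using pair_no_loops[of "(i, i)"] by auto
  have "bij_betw pat (Pow ?V) (S_znz G)"
  proof (rule bij_betwI[where g = "\<lambda>A. {i \<in> ?V. A (i, i) = Star}"])
    show "pat \<in> Pow ?V \<rightarrow> S_znz G"
    proof
      fix D
      have "pat D \<in> patterns ?V ?V"
        by (simp add: pat_def patterns_def)
      moreover have "pat D (i, j) = pat D (j, i)" if "i \<in> ?V" "j \<in> ?V" for i j
        using that arcs_sym[of i j] by (simp add: pat_def conj_commute eq_commute) metis
      moreover have "pat D (i, j) = Star \<longleftrightarrow> (i, j) \<in> parcs G"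
        if "i \<in> ?V" "j \<in> ?V" "i \<noteq> j" for i j
        using that by (simp add: pat_def)
      ultimately show "pat D \<in> S_znz G"
        by (simp add: S_znz_def)
    qed
    show "(\<lambda>A. {i \<in> ?V. A (i, i) = Star}) \<in> S_znz G \<rightarrow> Pow ?V"
      by auto
    show "{i \<in> ?V. pat D (i, i) = Star} = D" if "D \<in> Pow ?V" for D
      using that irrefl by (auto simp: pat_def)
    show "pat {i \<in> ?V. A (i, i) = Star} = A" if "A \<in> S_znz G" for A
    proof (rule PiE_ext)
      show "pat {i \<in> ?V. A (i, i) = Star} \<in> ?V \<times> ?V \<rightarrow>\<^sub>E UNIV"
        by (simp add: pat_def)
      show "A \<in> ?V \<times> ?V \<rightarrow>\<^sub>E UNIV"
        using that by (simp add: S_znz_def patterns_def)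
      fix p
      assume "p \<in> ?V \<times> ?V"
      then obtain i j where p: "p = (i, j)" "i \<in> ?V" "j \<in> ?V"
        by auto
      with that have "i \<noteq> j \<Longrightarrow> A (i, j) = Star \<longleftrightarrow> (i, j) \<in> parcs G"
        by (simp add: S_znz_def)
      with p show "pat {i \<in> ?V. A (i, i) = Star} p = A p"
        using irrefl by (cases "i = j"; cases "A (i, j)") (simp_all add: pat_def)
    qed
  qed
  then show ?thesis
    using bij_betw_same_card[of pat] card_Pow[of ?V] pair_finite_verts by metis
qed

end

theory Submission
  imports Defs
begin

text \<open>
  Listing the forces \<open>v\<^sub>0 \<rightarrow> u\<^sub>0, v\<^sub>1 \<rightarrow> u\<^sub>1, \<dots>\<close> of a forcing sequence gives
  triangular enumerations of \<open>R\<close> and \<open>C\<close>: when \<open>v\<^sub>i\<close> forces \<open>u\<^sub>i\<close>, it is filled and the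
  later \<open>u\<^sub>j\<close> are unfilled non-neighbors of it, so neither an edge nor the diagonal
  makes the entry at \<open>(v\<^sub>i, u\<^sub>j)\<close> a star.

  Conversely, choose the diagonal adversarially: put a star at \<open>(v, v)\<close> exactly when \<open>v\<close> has a
  neighbor in \<open>C\<close>. Then no row indexed by a vertex of \<open>C\<close> has exactly one star in \<open>C\<close>, so the
  first row of the triangle is indexed by a filled vertex with exactly one unfilled
  neighbor, which is a possible force. As this row does not meet the diagonal, deleting it together
  with its column leaves a persistent triangle, and one proceeds by induction.
\<close>

section \<open>Triangles and their deletions\<close>

lemma triangle_subpattern_iff [simp]: "triangle R C (subpattern A R C) \<longleftrightarrow> triangle R C A"
proof -
  have "lower_triangular_star_diag (card R) (\<lambda>i j. subpattern A R C (r i, c j)) \<longleftrightarrow>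
      lower_triangular_star_diag (card R) (\<lambda>i j. A (r i, c j))"
    if "card R = card C" "bij_betw r {..<card R} R" "bij_betw c {..<card C} C" for r c
    using that bij_betwE[OF that(2)] bij_betwE[OF that(3)]
    by (auto simp: lower_triangular_star_diag_def subpattern_def)
  then show ?thesis
    unfolding triangle_def by blast
qed

lemma znz_not_Star_iff: "x \<noteq> Star \<longleftrightarrow> x = Zero"
  by (cases x) auto

text \<open>In the first row of a triangular order, every entry off the diagonal lies above it, so
  the diagonal star is the only one.\<close>

lemma triangle_has_singleton_row:
  assumes "triangle R C A" "finite R" "R \<noteq> {}"
  obtains r c where "r \<in> R" "{c' \<in> C. A (r, c') = Star} = {c}"
proof -
  obtain r c where card: "card R = card C"
    and r: "bij_betw r {..<card R} R" and c: "bij_betw c {..<card R} C"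
    and tri: "lower_triangular_star_diag (card R) (\<lambda>i j. A (r i, c j))"
    using assms(1) by (auto simp: triangle_def)
  have pos: "0 < card R"
    using assms(2,3) by (simp add: card_gt_0_iff)
  have "c' = c 0" if "c' \<in> C" "A (r 0, c') = Star" for c'
  proof -
    obtain j where "j < card R" "c' = c j"
      using c \<open>c' \<in> C\<close> unfolding bij_betw_def by blast
    with tri pos that(2) show ?thesis
      by (cases "j = 0") (auto simp: lower_triangular_star_diag_def)
  qed
  moreover have "c 0 \<in> C" "A (r 0, c 0) = Star" "r 0 \<in> R"
    using bij_betwE[OF r] bij_betwE[OF c] tri pos by (auto simp: lower_triangular_star_diag_def)
  ultimately show ?thesis
    using that[of "r 0" "c 0"] by blast
qed

text \<open>Order-preserving renumbering that closes the gap left by a deleted row and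
  column.\<close>

lemma bij_betw_skip:
  fixes k n :: nat
  assumes "k < Suc n"
  shows "bij_betw (\<lambda>i. if i < k then i else Suc i) {..<n} ({..<Suc n} - {k})"
  by (rule bij_betwI[where g = "\<lambda>i. if i < k then i else i - 1"]) (use assms in \<open>auto split: if_splits\<close>)

text \<open>The row \<open>r\<close> may sit at any position \<open>k\<close> of the triangular
  order, which varies with \<open>A\<close>. Its only star must be its diagonal one, so
  \<open>c\<close> is the column at the same position, and dropping position \<open>k\<close> from
  both enumerations keeps the triangular shape.\<close>

lemma triangle_delete_singleton_row:
  assumes tri: "triangle R C A" and fin: "finite R" and "r \<in> R"
    and row: "{c' \<in> C. A (r, c') = Star} = {c}"
  shows "triangle (R - {r}) (C - {c}) A"
proof -
  obtain p q where card: "card R = card C"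
    and p: "bij_betw p {..<card R} R" and q: "bij_betw q {..<card R} C"
    and lt: "lower_triangular_star_diag (card R) (\<lambda>i j. A (p i, q j))"
    using tri by (auto simp: triangle_def)
  obtain k where k: "k < card R" "r = p k"
    using p \<open>r \<in> R\<close> by (auto simp: bij_betw_def)
  have "q k \<in> C" "A (p k, q k) = Star"
    using bij_betwE[OF q] lt k(1) by (auto simp: lower_triangular_star_diag_def)
  then have c: "c = q k"
    using row k(2) by auto
  obtain n where n: "card R = Suc n"
    using k(1) by (cases "card R") auto
  define s where "s i = (if i < k then i else Suc i)" for i
  have s: "bij_betw s {..<n} ({..<card R} - {k})"
    using bij_betw_skip[of k n] k(1) n unfolding s_def by metis
  have "card (R - {r}) = n"
    using \<open>r \<in> R\<close> n by simp
  moreover have "card (C - {c}) = n"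
    using \<open>q k \<in> C\<close> c card n by simp
  moreover have "bij_betw (p \<circ> s) {..<n} (R - {r})"
    using s p k by (intro bij_betw_trans[OF s] bij_betw_DiffI) (auto simp: bij_betw_def)
  moreover have "bij_betw (q \<circ> s) {..<n} (C - {c})"
    using s q k(1) \<open>q k \<in> C\<close> c
    by (intro bij_betw_trans[OF s] bij_betw_DiffI) (auto simp: bij_betw_def)
  \<comment> \<open>Since \<open>s\<close> is strictly increasing, entries above the diagonal come
    from entries above the old diagonal.\<close>
  moreover have "lower_triangular_star_diag n (\<lambda>i j. A ((p \<circ> s) i, (q \<circ> s) j))"
    using lt n by (auto simp: lower_triangular_star_diag_def s_def)
  ultimately show ?thesis
    unfolding triangle_def by metis
qed

section \<open>From persistent triangles to forcing sequences\<close>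

lemma S_znz_off_diagonal:
  assumes "A \<in> S_znz G" "i \<in> pverts G" "j \<in> pverts G" "i \<noteq> j"
  shows "A (i, j) = Star \<longleftrightarrow> (i, j) \<in> parcs G"
  using assms by (simp add: S_znz_def)

context pair_graph
begin

lemma S_znz_with_diagonal:
  obtains A where "A \<in> S_znz G" "\<And>i. i \<in> pverts G \<Longrightarrow> A (i, i) = Star \<longleftrightarrow> i \<in> D"
proof -
  define A where "A = restrict
    (\<lambda>(i, j). if i = j then if i \<in> D then Star else Zero
               else if (i, j) \<in> parcs G then Star else Zero) (pverts G \<times> pverts G)"
  have "(i, j) \<in> parcs G \<longleftrightarrow> (j, i) \<in> parcs G" for i j
    using pair_sym_arcs by (auto simp: symmetric_def sym_def)
  then have "A \<in> S_znz G"
    by (auto simp: S_znz_def patterns_def A_def)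
  moreover have "A (i, i) = Star \<longleftrightarrow> i \<in> D" if "i \<in> pverts G" for i
    using that by (simp add: A_def)
  ultimately show ?thesis
    using that by blast
qed

lemma persistent_triangle_force:
  assumes sub: "R \<subseteq> pverts G" "C \<subseteq> pverts G" and "R \<noteq> {}"
    and tri: "\<And>A. A \<in> S_znz G \<Longrightarrow> triangle R C A"
  obtains r c where "r \<in> R" "r \<notin> C" "{w \<in> C. (r, w) \<in> parcs G} = {c}"
proof -
  obtain A where A: "A \<in> S_znz G"
    and diag: "\<And>i. i \<in> pverts G \<Longrightarrow> A (i, i) = Star \<longleftrightarrow> i \<in> {v. \<exists>w\<in>C. (v, w) \<in> parcs G}"
    using S_znz_with_diagonal by blast
  have "finite R"
    using sub(1) finite_subset pair_finite_verts by blast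
  then obtain r c where r: "r \<in> R" and row: "{c' \<in> C. A (r, c') = Star} = {c}"
    using triangle_has_singleton_row[OF tri[OF A] _ \<open>R \<noteq> {}\<close>] by blast
  have rV: "r \<in> pverts G"
    using r sub by blast
  have off: "A (r, w) = Star \<longleftrightarrow> (r, w) \<in> parcs G" if "w \<in> C" "w \<noteq> r" for w
    using S_znz_off_diagonal[OF A rV] that sub by blast
  have irrefl: "(r, r) \<notin> parcs G"
    using pair_no_loops[of "(r, r)"] by auto
  have "r \<notin> C"
  proof
    assume "r \<in> C"
    have c: "c \<in> C" "A (r, c) = Star"
      using row by auto
    \<comment> \<open>The star at \<open>c\<close> is either off the diagonal, so that
      \<open>c\<close> is a neighbor, or on it, so that the choice of diagonal supplies a neighbor
      in \<open>C\<close>. Either way that choice also puts a star at \<open>(r, r)\<close>, so row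
      \<open>r\<close> has two stars.\<close>
    obtain w where w: "w \<in> C" "(r, w) \<in> parcs G"
      using c diag[OF rV] off[of c] by (cases "c = r") auto
    then have "w \<noteq> r" "A (r, w) = Star" "A (r, r) = Star"
      using irrefl off[of w] diag[OF rV] by auto
    then have "w \<in> {c}" "r \<in> {c}"
      using w(1) \<open>r \<in> C\<close> unfolding row[symmetric] by auto
    with \<open>w \<noteq> r\<close> show False
      by simp
  qed
  moreover from this have "{w \<in> C. (r, w) \<in> parcs G} = {c' \<in> C. A (r, c') = Star}"
    using off by auto
  ultimately show ?thesis
    using that r row by simp
qed

lemma persistent_triangle_imp_forcing_sequence:
  assumes "R \<subseteq> pverts G" "C \<subseteq> pverts G" "card R = card C"
    and "\<And>A. A \<in> S_znz G \<Longrightarrow> triangle R C A"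
  shows "\<exists>fs. forcing_sequence G (pverts G - C) fs \<and> fst ` set fs = R \<and> snd ` set fs = C"
  using assms
proof (induction "card R" arbitrary: R C)
  case 0
  then have "R = {}" "C = {}"
    using finite_subset[OF _ pair_finite_verts] by (metis card_0_eq)+
  then show ?case
    by (intro exI[of _ "[]"]) simp
next
  case (Suc n)
  have fin: "finite R"
    using Suc.prems(1) finite_subset pair_finite_verts by blast
  have "R \<noteq> {}"
    using Suc.hyps(2) by auto
  then obtain r c where r: "r \<in> R" "r \<notin> C" and nbr: "{w \<in> C. (r, w) \<in> parcs G} = {c}"
    using persistent_triangle_force[OF Suc.prems(1,2) _ Suc.prems(4)] by metis
  have c: "c \<in> C"
    using nbr by auto
  \<comment> \<open>The pair \<open>r\<close>, \<open>c\<close> is fixed before \<open>A\<close>. As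
    \<open>r \<notin> C\<close>, row \<open>r\<close> avoids the diagonal inside \<open>C\<close>,
    so edges alone determine it and \<open>c\<close> is its only star in every pattern.\<close>
  have "triangle (R - {r}) (C - {c}) A" if A: "A \<in> S_znz G" for A
  proof (rule triangle_delete_singleton_row[OF Suc.prems(4)[OF A] fin r(1)])
    have "A (r, w) = Star \<longleftrightarrow> (r, w) \<in> parcs G" if "w \<in> C" for w
      using S_znz_off_diagonal[OF A, of r w] that r Suc.prems(1,2) by blast
    then show "{w \<in> C. A (r, w) = Star} = {c}"
      using nbr by blast
  qed
  moreover have "n = card (R - {r})" "card (R - {r}) = card (C - {c})"
    using Suc.hyps(2) Suc.prems(3) r(1) c by simp_all
  ultimately obtain fs where fs: "forcing_sequence G (pverts G - (C - {c})) fs"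
    "fst ` set fs = R - {r}" "snd ` set fs = C - {c}"
    using Suc.hyps(1)[of "R - {r}" "C - {c}"] Suc.prems(1,2) by blast
  \<comment> \<open>The smaller instance starts from exactly the vertices filled once
    \<open>r\<close> has forced \<open>c\<close>, so its sequence can follow that force.\<close>
  have "pverts G - (C - {c}) = insert c (pverts G - C)"
    using c Suc.prems(2) by auto
  moreover have "forces G (pverts G - C) r c"
  proof -
    have "{w. (r, w) \<in> parcs G \<and> w \<notin> pverts G - C} = {w \<in> C. (r, w) \<in> parcs G}"
      using in_arcsD2 Suc.prems(2) by fastforce
    then show ?thesis
      using nbr r Suc.prems(1) by (auto simp: forces_def)
  qed
  ultimately show ?case
    using fs r(1) c by (intro exI[of _ "(r, c) # fs"]) auto
qed

end

section \<open>From forcing sequences to persistent triangles\<close>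

lemma forcing_sequence_nth:
  assumes "forcing_sequence G B fs" "i < length fs"
  shows "forces G (B \<union> snd ` set (take i fs)) (fst (fs ! i)) (snd (fs ! i))"
  using assms
proof (induction fs arbitrary: B i)
  case (Cons f fs)
  then show ?case
    by (cases i) (fastforce simp: insert_commute)+
qed simp

text \<open>A vertex is unfilled just before it is forced, and filled vertices stay filled.\<close>

lemma forcing_sequence_distinct_forced:
  assumes "forcing_sequence G B fs"
  shows "distinct (map snd fs)" "B \<inter> snd ` set fs = {}"
proof -
  have "distinct (map snd fs) \<and> B \<inter> snd ` set fs = {}"
    using assms
  proof (induction fs arbitrary: B)
    case (Cons f fs)
    have "distinct (map snd fs)" "insert (snd f) B \<inter> snd ` set fs = {}"
      using Cons.IH[of "insert (snd f) B"] Cons.prems by simp_all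
    moreover have "snd f \<notin> B"
      using Cons.prems unfolding forcing_sequence.simps forces_def by blast
    ultimately show ?case
      by auto
  qed simp
  then show "distinct (map snd fs)" "B \<inter> snd ` set fs = {}"
    by auto
qed

lemma (in pair_graph) forcing_sequence_forced_subset:
  assumes "forcing_sequence G B fs"
  shows "snd ` set fs \<subseteq> pverts G"
  using assms
proof (induction fs arbitrary: B)
  case (Cons f fs)
  then have "(fst f, snd f) \<in> parcs G"
    unfolding forcing_sequence.simps forces_def by blast
  then show ?case
    using Cons in_arcsD2 by fastforce
qed simp

lemma (in pair_graph) forcing_sequence_triangle:
  assumes fs: "forcing_sequence G (pverts G - C) fs" and C: "snd ` set fs = C"
    and "C \<subseteq> pverts G" and R: "fst ` set fs = R" and "R \<subseteq> pverts G" and A: "A \<in> S_znz G"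
  shows "triangle R C A"
proof -
  let ?n = "length fs" and ?B = "\<lambda>i. pverts G - C \<union> snd ` set (take i fs)"
  have df: "distinct (map fst fs)" and ds: "distinct (map snd fs)"
    using forcing_sequence_distinct[OF fs] forcing_sequence_distinct_forced(1)[OF fs] .
  have r: "bij_betw (\<lambda>i. fst (fs ! i)) {..<?n} R"
    using bij_betw_nth[OF df, of "{..<?n}" R] R
      bij_betw_cong[of "{..<?n}" "(!) (map fst fs)" "\<lambda>i. fst (fs ! i)" R] by simp
  have c: "bij_betw (\<lambda>i. snd (fs ! i)) {..<?n} C"
    using bij_betw_nth[OF ds, of "{..<?n}" C] C
      bij_betw_cong[of "{..<?n}" "(!) (map snd fs)" "\<lambda>i. snd (fs ! i)" C] by simp
  have card: "card R = ?n" "card C = ?n"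
    using bij_betw_same_card[OF r] bij_betw_same_card[OF c] by simp_all
  have V: "fst (fs ! i) \<in> pverts G" "snd (fs ! i) \<in> pverts G" "snd (fs ! i) \<in> C" if "i < ?n" for i
    using that R C \<open>R \<subseteq> _\<close> \<open>C \<subseteq> _\<close> nth_mem[OF that] by blast+
  \<comment> \<open>\<open>?B i\<close> is the filled set just before force number \<open>i\<close>,
    so the case \<open>j = i\<close> is included.\<close>
  have unfilled: "snd (fs ! j) \<notin> ?B i" if "i \<le> j" "j < ?n" for i j
  proof -
    have "snd (fs ! j) \<noteq> snd (fs ! k)" if "k < i" for k
      using ds that \<open>i \<le> j\<close> \<open>j < ?n\<close> nth_eq_iff_index_eq[OF ds, of j k] by auto
    then have "snd (fs ! j) \<notin> snd ` set (take i fs)"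
      by (fastforce simp: in_set_conv_nth)
    then show ?thesis
      using V(3)[OF that(2)] by blast
  qed
  \<comment> \<open>The forcer is filled and the target at \<open>j\<close> is not, so they differ
    and the entry is determined by adjacency. The only unfilled neighbor of the forcer is its own
    target.\<close>
  have entry: "A (fst (fs ! i), snd (fs ! j)) = Star \<longleftrightarrow> i = j" if "i \<le> j" "j < ?n" for i j
  proof -
    have i: "i < ?n"
      using that by simp
    have f: "forces G (?B i) (fst (fs ! i)) (snd (fs ! i))"
      by (rule forcing_sequence_nth[OF fs i])
    then have "fst (fs ! i) \<noteq> snd (fs ! j)"
      using unfilled[OF that] unfolding forces_def by metis
    then have "A (fst (fs ! i), snd (fs ! j)) = Star \<longleftrightarrow> (fst (fs ! i), snd (fs ! j)) \<in> parcs G"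
      by (rule S_znz_off_diagonal[OF A V(1)[OF i] V(2)[OF that(2)]])
    also have "\<dots> \<longleftrightarrow> snd (fs ! j) = snd (fs ! i)"
      using f unfilled[OF that] unfolding forces_def by blast
    also have "\<dots> \<longleftrightarrow> i = j"
      using nth_eq_iff_index_eq[OF ds, of j i] that i by auto
    finally show ?thesis .
  qed
  have "A (fst (fs ! i), snd (fs ! j)) = Zero" if "i < j" "j < ?n" for i j
    using entry[of i j] that by (simp add: znz_not_Star_iff)
  moreover have "A (fst (fs ! i), snd (fs ! i)) = Star" if "i < ?n" for i
    using entry[of i i] that by blast
  ultimately have "lower_triangular_star_diag ?n (\<lambda>i j. A (fst (fs ! i), snd (fs ! j)))"
    unfolding lower_triangular_star_diag_def by blast
  then show ?thesis
    unfolding triangle_def card using r c by blast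
qed

theorem theorem2p7:
  fixes G :: "'a pair_pre_digraph" and R C :: "'a set"
  assumes "pair_graph G"
    and "R \<subseteq> pverts G" and "C \<subseteq> pverts G"
    and "card R = card C"
  shows "persistent_triangle G R C \<longleftrightarrow>
    zero_forcing_set_with_forcers G (pverts G - C) R"
proof -
  interpret pair_graph G
    by (fact assms(1))
  show ?thesis
  proof
    assume "persistent_triangle G R C"
    then obtain fs where fs: "forcing_sequence G (pverts G - C) fs"
      "fst ` set fs = R" "snd ` set fs = C"
      using persistent_triangle_imp_forcing_sequence[OF assms(2-4)]
      by (auto simp: persistent_triangle_def)
    then have "filled_after (pverts G - C) fs = pverts G"
      using assms(3) by (auto simp: filled_after_def)
    \<comment> \<open>Once all vertices are filled, no unfilled neighbor remains, so the sequence is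
      complete.\<close>
    moreover have "\<not> forces G (pverts G) v u" for v u
      using in_arcsD2 by (fastforce simp: forces_def)
    ultimately show "zero_forcing_set_with_forcers G (pverts G - C) R"
      using fs by (auto simp: zero_forcing_set_with_forcers_def zero_forcing_set_def
          complete_forcing_sequence_def forcing_vertices_def)
  next
    assume "zero_forcing_set_with_forcers G (pverts G - C) R"
    then obtain fs where fs: "forcing_sequence G (pverts G - C) fs" and R: "fst ` set fs = R"
      by (auto simp: zero_forcing_set_with_forcers_def complete_forcing_sequence_def
          forcing_vertices_def)
    \<comment> \<open>Forcers are distinct and targets are distinct, so there are as many targets as
      elements of \<open>R\<close>. The targets start unfilled, hence lie in \<open>C\<close>, and
      by cardinality they exhaust it.\<close>
    have "card (snd ` set fs) = card C"
      using forcing_sequence_distinct[OF fs] forcing_sequence_distinct_forced(1)[OF fs] R assms(4)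
      by (metis distinct_card length_map list.set_map)
    moreover have "snd ` set fs \<subseteq> C"
      using forcing_sequence_distinct_forced(2)[OF fs] forcing_sequence_forced_subset[OF fs]
      by blast
    ultimately have "snd ` set fs = C"
      using assms(3) card_subset_eq finite_subset pair_finite_verts by metis
    then show "persistent_triangle G R C"
      using forcing_sequence_triangle[OF fs _ assms(3) R assms(2)] assms
      by (simp add: persistent_triangle_def)
  qed
qed

end
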